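(* Let $\mathcal{A}=\{H_1,\dots,H_k\}$ be a hyperplane arrangement in $\mathbb{R}^n$, $H_i=\{x:w_i\cdot x=a_i\}$, and let $V\in\mathcal{L}(\underline{\mathcal{A}})$. Let $I_u=\{i: V\not\subseteq\underline{H_i}\}$ and $I_b=\{i: V\subseteq\underline{H_i}\}$ (so the hyperplanes of $\underline{\mathcal{A}}^V$ are the $\underline{H_i}\cap V$, $i\in I_u$, and $\mathcal{A}_V=\{H_i:i\in I_b\}$). For a region $R$ of $\mathcal{A}$ with $V_R=V$ define \[R_u=\{x\in V: \sigma(R)_i(w_i\cdot x)>0 \text{ for all } i\in I_u\},\qquad R_b=\{x\in\mathbb{R}^n:\sigma(R)_i(w_i\cdot x-a_i)>0 \text{ for all } i\in I_b\}.\] Then $\Phi_V: R\mapsto(R_u,R_b)$ is a well-defined bijection from the set of regions $R$ of $\mathcal{A}$ with $V_R=V$ onto the set of pairs consisting of a region of $\underline{\mathcal{A}}^V$ and a relatively bounded region of $\mathcal{A}_V$; its inverse sends $(R_u,R_b)$ to the region of $\mathcal{A}$ whose sign in coordinate $i$ is the sign of $R_u$ for $i\in I_u$ and the sign of $R_b$ for $i\in I_b$. In particular, the number of regions $R$ of $\mathcal{A}$ with $V_R=V$ equals $r(\underline{\mathcal{A}}^V)\,b(\mathcal{A}_V)$.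
   Context: A hyperplane arrangement is a finite set of affine hyperplanes in $\mathbb{R}^n$; each is written $H_i=\{x:w_i\cdot x=a_i\}$, $w_i\neq0$. A region is a connected component of the complement of the union; its sign vector $\sigma(R)\in\{\pm1\}^k$ satisfies $\sigma(R)_i(w_i\cdot x-a_i)>0$ for $x\in R$ (for sub-arrangements, signs are taken with respect to the same $w_i,a_i$). $\operatorname{Rec}(R)=\{v:R+v\subseteq R\}$ and $V_R=\operatorname{span}(\operatorname{Rec}(R))$. Centralization: $\underline{H_i}=\{x:w_i\cdot x=0\}$, $\underline{\mathcal{A}}=\{\underline{H_i}\}$. $\mathcal{L}(\mathcal{B})$ is the set of nonempty intersections of subsets of hyperplanes of $\mathcal{B}$ (including $\mathbb{R}^n$). Restriction: $\mathcal{B}^V=\{H\cap V:H\in\mathcal{B}\}\setminus\{\emptyset,V\}$, an arrangement in $V$. Localization at a linear subspace $V$: $\mathcal{A}_V=\{H\in\mathcal{A}: V\subseteq H\text{ or }V\cap H=\emptyset\}$. $r(\mathcal{B})$ is the number of regions of $\mathcal{B}$. A region $R$ of $\mathcal{B}$ is relatively bounded if $R\cap W$ is bounded, where $W$ is the span of the normal vectors of the hyperplanes of $\mathcal{B}$; $b(\mathcal{B})$ is the number of relatively bounded regions. *)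

theory Defs
  imports "HOL-Analysis.Analysis"
begin

definition hyperplane :: "'a::real_inner \<Rightarrow> real \<Rightarrow> 'a set" where
  "hyperplane w a = {x. w \<bullet> x = a}"

text \<open>
  An arrangement is a set of hyperplanes. In the statement it is the image of a finite index set
  under a family of equations, which may repeat a hyperplane. The first argument of \<open>regions\<close>
  is the ambient space: \<open>UNIV\<close>, or the subspace \<open>V\<close> for a restriction to \<open>V\<close>.
\<close>

definition arrangement :: "('i \<Rightarrow> 'a::real_inner) \<Rightarrow> ('i \<Rightarrow> real) \<Rightarrow> 'i set \<Rightarrow> 'a set set" where
  "arrangement w a I = (\<lambda>i. hyperplane (w i) (a i)) ` I"

definition centralization :: "('i \<Rightarrow> 'a::real_inner) \<Rightarrow> 'i set \<Rightarrow> 'a set set" where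
  "centralization w I = (\<lambda>i. hyperplane (w i) 0) ` I"

definition regions :: "'a::real_inner set \<Rightarrow> 'a set set \<Rightarrow> 'a set set" where
  "regions S \<B> = components (S - \<Union>\<B>)"

text \<open>
  For a region of an arrangement containing the \<open>i\<close>-th hyperplane, there is exactly one
  such sign; otherwise the value may be unspecified.
\<close>

definition sign_vector ::
    "('i \<Rightarrow> 'a::real_inner) \<Rightarrow> ('i \<Rightarrow> real) \<Rightarrow> 'a set \<Rightarrow> 'i \<Rightarrow> real" where
  "sign_vector w a R i = (THE s. s \<in> {-1, 1} \<and> (\<forall>x\<in>R. s * (w i \<bullet> x - a i) > 0))"

definition Rec :: "'a::real_inner set \<Rightarrow> 'a set" where
  "Rec R = {v. (\<lambda>x. x + v) ` R \<subseteq> R}"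

definition rec_span :: "'a::real_inner set \<Rightarrow> 'a set" where
  "rec_span R = span (Rec R)"

text \<open>The subset \<open>{}\<close> contributes \<open>\<Inter>{} = UNIV\<close>.\<close>

definition intersection_poset :: "'a::real_inner set set \<Rightarrow> 'a set set" where
  "intersection_poset \<B> = {\<Inter>\<C> | \<C>. \<C> \<subseteq> \<B> \<and> \<Inter>\<C> \<noteq> {}}"

definition restriction :: "'a::real_inner set set \<Rightarrow> 'a set \<Rightarrow> 'a set set" where
  "restriction \<B> V = {H \<inter> V | H. H \<in> \<B>} - {{}, V}"

definition localization :: "'a::real_inner set set \<Rightarrow> 'a set \<Rightarrow> 'a set set" where
  "localization \<A> V = {H \<in> \<A>. V \<subseteq> H \<or> V \<inter> H = {}}"

definition normal_span :: "'a::real_inner set set \<Rightarrow> 'a set" where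
  "normal_span \<B> = span {w. w \<noteq> 0 \<and> (\<exists>a. hyperplane w a \<in> \<B>)}"

definition rel_bounded_regions :: "'a::real_inner set set \<Rightarrow> 'a set set" where
  "rel_bounded_regions \<B> = {R \<in> regions UNIV \<B>. bounded (R \<inter> normal_span \<B>)}"

definition num_regions :: "'a::real_inner set \<Rightarrow> 'a set set \<Rightarrow> nat" where
  "num_regions S \<B> = card (regions S \<B>)"

definition num_rel_bounded_regions :: "'a::real_inner set set \<Rightarrow> nat" where
  "num_rel_bounded_regions \<B> = card (rel_bounded_regions \<B>)"

definition I_u :: "('i \<Rightarrow> 'a::real_inner) \<Rightarrow> 'i set \<Rightarrow> 'a set \<Rightarrow> 'i set" where
  "I_u w I V = {i \<in> I. \<not> V \<subseteq> hyperplane (w i) 0}"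

definition I_b :: "('i \<Rightarrow> 'a::real_inner) \<Rightarrow> 'i set \<Rightarrow> 'a set \<Rightarrow> 'i set" where
  "I_b w I V = {i \<in> I. V \<subseteq> hyperplane (w i) 0}"

definition R_u ::
    "('i \<Rightarrow> 'a::real_inner) \<Rightarrow> ('i \<Rightarrow> real) \<Rightarrow> 'i set \<Rightarrow> 'a set \<Rightarrow> 'a set \<Rightarrow> 'a set" where
  "R_u w a I V R = {x \<in> V. \<forall>i \<in> I_u w I V. sign_vector w a R i * (w i \<bullet> x) > 0}"

definition R_b ::
    "('i \<Rightarrow> 'a::real_inner) \<Rightarrow> ('i \<Rightarrow> real) \<Rightarrow> 'i set \<Rightarrow> 'a set \<Rightarrow> 'a set \<Rightarrow> 'a set" where
  "R_b w a I V R = {x. \<forall>i \<in> I_b w I V. sign_vector w a R i * (w i \<bullet> x - a i) > 0}"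

definition Phi ::
    "('i \<Rightarrow> 'a::real_inner) \<Rightarrow> ('i \<Rightarrow> real) \<Rightarrow> 'i set \<Rightarrow> 'a set \<Rightarrow> 'a set \<Rightarrow> 'a set \<times> 'a set" where
  "Phi w a I V R = (R_u w a I V R, R_b w a I V R)"

definition regions_with_span :: "'a::real_inner set set \<Rightarrow> 'a set \<Rightarrow> 'a set set" where
  "regions_with_span \<A> V = {R \<in> regions UNIV \<A>. rec_span R = V}"

end

theory Submission
  imports Defs
begin

text \<open>
  Regions are the nonempty sign cells, so everything can be read off sign vectors. The recession
  cone of the cell with signs \<open>s\<close> is \<open>{v. \<forall>i. s\<^sub>i (w\<^sub>i \<bullet> v) \<ge> 0}\<close>. If it spans \<open>V\<close>, a sum of
  recession directions is strictly positive on all of \<open>I_u\<close>, so \<open>R_u\<close> is nonempty; a nonzero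
  recession direction of \<open>R_b\<close> orthogonal to \<open>V\<close>, added to such a point with a small
  coefficient, would be a recession direction of \<open>R\<close> outside \<open>V\<close>, so \<open>R_b\<close> is relatively bounded.
  Conversely, moving far from a point of \<open>R_b\<close> along a direction in \<open>R_u\<close> reaches the
  cell with the combined signs, whose recession cone contains the relatively open subset \<open>R_u\<close>
  of \<open>V\<close> and projects to zero orthogonally to \<open>V\<close>.
\<close>

section \<open>Sign cells and regions\<close>

text \<open>The ambient set \<open>S\<close> lets one notion serve for \<open>UNIV\<close>, for the
  flat \<open>V\<close> and for the span \<open>N\<close> of the localized normals. The signs are
  arbitrary reals here; the values -1 and 1 are imposed where regions are described.\<close>

definition cell ::
    "'a::real_inner set \<Rightarrow> ('i \<Rightarrow> 'a) \<Rightarrow> ('i \<Rightarrow> real) \<Rightarrow> 'i set \<Rightarrow> ('i \<Rightarrow> real) \<Rightarrow> 'a set" where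
  "cell S w a J s = {x \<in> S. \<forall>i\<in>J. s i * (w i \<bullet> x - a i) > 0}"

lemma cell_cong: "(\<And>i. i \<in> J \<Longrightarrow> s i = t i) \<Longrightarrow> cell S w a J s = cell S w a J t"
  by (auto simp: cell_def)

lemma convex_cell:
  assumes "convex S"
  shows "convex (cell S w a J s)"
proof (rule convexI)
  fix x y and u v :: real
  assume x: "x \<in> cell S w a J s" and y: "y \<in> cell S w a J s"
    and uv: "0 \<le> u" "0 \<le> v" "u + v = 1"
  have "s i * (w i \<bullet> (u *\<^sub>R x + v *\<^sub>R y) - a i) > 0" if "i \<in> J" for i
  proof -
    let ?p = "s i * (w i \<bullet> x - a i)" and ?q = "s i * (w i \<bullet> y - a i)"
    have pq: "?p > 0" "?q > 0"
      using x y that by (auto simp: cell_def)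
    have "a i = u * a i + v * a i"
      using uv(3) by (metis distrib_right mult_1)
    then have "s i * (w i \<bullet> (u *\<^sub>R x + v *\<^sub>R y) - a i)
        = s i * ((u * (w i \<bullet> x) + v * (w i \<bullet> y)) - (u * a i + v * a i))"
      by (simp add: inner_right_distrib)
    also have "\<dots> = u * ?p + v * ?q"
      by (simp add: algebra_simps)
    also have "\<dots> > 0"
    proof (cases "u = 0")
      case True
      then show ?thesis using uv pq by simp
    next
      case False
      then have "u * ?p > 0" using uv pq by simp
      moreover have "v * ?q \<ge> 0" using uv pq by simp
      ultimately show ?thesis by linarith
    qed
    finally show ?thesis .
  qed
  moreover have "u *\<^sub>R x + v *\<^sub>R y \<in> S"
    using assms x y uv by (auto simp: cell_def convex_def)
  ultimately show "u *\<^sub>R x + v *\<^sub>R y \<in> cell S w a J s"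
    by (simp add: cell_def)
qed

text \<open>The functional maps \<open>C\<close> onto a connected set of reals that misses
  \<open>a\<close>, so all its values lie on one side of \<open>a\<close>.\<close>

lemma connected_inner_sgn_eq:
  fixes C :: "'a::real_inner set"
  assumes "connected C" "x \<in> C" "y \<in> C" and avoid: "\<And>z. z \<in> C \<Longrightarrow> w \<bullet> z \<noteq> a"
  shows "sgn (w \<bullet> x - a) = sgn (w \<bullet> y - a)"
proof -
  have conn: "connected ((\<lambda>z. w \<bullet> z) ` C)"
    by (intro connected_continuous_image continuous_intros assms)
  have "a \<notin> (\<lambda>z. w \<bullet> z) ` C"
    using avoid by blast
  then have "\<not> (w \<bullet> x \<le> a \<and> a \<le> w \<bullet> y)" "\<not> (w \<bullet> y \<le> a \<and> a \<le> w \<bullet> x)"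
    using conn assms(2,3) unfolding connected_iff_interval by blast+
  then show ?thesis
    by (auto simp: sgn_real_def)
qed

text \<open>No sign can change along a connected set that avoids the hyperplanes, so the component
  lies in the cell. The cell is convex, hence connected, and avoids the hyperplanes, so maximality
  of the component gives the reverse inclusion.\<close>

lemma connected_component_set_complement:
  fixes S :: "'a::real_inner set"
  assumes "convex S" and x: "x \<in> S - \<Union>(arrangement w a J)"
  shows "connected_component_set (S - \<Union>(arrangement w a J)) x
    = cell S w a J (\<lambda>i. sgn (w i \<bullet> x - a i))" (is "?L = ?R")
proof
  show "?L \<subseteq> ?R"
  proof
    fix y assume "y \<in> ?L"
    then obtain C where C: "connected C" "C \<subseteq> S - \<Union>(arrangement w a J)" "x \<in> C" "y \<in> C"
      unfolding connected_component_def by auto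
    have avoid: "w i \<bullet> z \<noteq> a i" if "z \<in> C" "i \<in> J" for z i
      using C(2) that by (auto simp: arrangement_def hyperplane_def)
    have "sgn (w i \<bullet> x - a i) * (w i \<bullet> y - a i) > 0" if "i \<in> J" for i
      using connected_inner_sgn_eq[OF C(1,3,4), of "w i" "a i"] avoid[OF C(4) that] avoid that
      by (auto simp: sgn_real_def split: if_splits)
    then show "y \<in> ?R"
      using C by (auto simp: cell_def)
  qed
  have "x \<in> ?R"
    using x by (auto simp: cell_def arrangement_def hyperplane_def sgn_real_def)
  moreover have "?R \<subseteq> S - \<Union>(arrangement w a J)"
    by (auto simp: cell_def arrangement_def hyperplane_def)
  moreover have "connected ?R"
    by (intro convex_connected convex_cell assms)
  ultimately show "?R \<subseteq> ?L"
    by (intro connected_component_maximal)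
qed

text \<open>The unions are compared only inside \<open>S\<close>, because the members of a
  restriction are traces on \<open>V\<close> rather than hyperplanes of the whole space.\<close>

lemma regions_iff_cell:
  fixes S :: "'a::real_inner set"
  assumes "convex S" and B: "S \<inter> \<Union>\<B> = S \<inter> \<Union>(arrangement w a J)"
  shows "R \<in> regions S \<B> \<longleftrightarrow> (\<exists>s. (\<forall>i\<in>J. s i \<in> {-1, 1}) \<and> R = cell S w a J s \<and> R \<noteq> {})"
    (is "?L \<longleftrightarrow> ?R")
proof -
  have eq: "S - \<Union>\<B> = S - \<Union>(arrangement w a J)"
    using B by blast
  show ?thesis
  proof
    assume ?L
    then obtain x where x: "x \<in> S - \<Union>(arrangement w a J)"
      and R: "R = connected_component_set (S - \<Union>(arrangement w a J)) x"
      unfolding regions_def eq by (auto simp: components_iff)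
    have "sgn (w i \<bullet> x - a i) \<in> {-1, 1}" if "i \<in> J" for i
      using x that by (auto simp: arrangement_def hyperplane_def sgn_real_def)
    moreover have "x \<in> R"
      unfolding R mem_Collect_eq using x by (rule connected_component_refl)
    ultimately show ?R
      using connected_component_set_complement[OF assms(1) x] R
      by (intro exI[of _ "\<lambda>i. sgn (w i \<bullet> x - a i)"]) auto
  next
    assume ?R
    then obtain s x where s: "\<And>i. i \<in> J \<Longrightarrow> s i \<in> {-1, 1}" and R: "R = cell S w a J s"
      and x: "x \<in> R"
      by auto
    have pos: "s i * (w i \<bullet> x - a i) > 0" if "i \<in> J" for i
      using R x that by (auto simp: cell_def)
    have xin: "x \<in> S - \<Union>(arrangement w a J)"
      using R x by (auto simp: cell_def arrangement_def hyperplane_def)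
    have "s i = sgn (w i \<bullet> x - a i)" if "i \<in> J" for i
      using pos[OF that] s[OF that] by (auto simp: sgn_real_def)
    then have "R = connected_component_set (S - \<Union>(arrangement w a J)) x"
      unfolding connected_component_set_complement[OF assms(1) xin] R by (rule cell_cong)
    then show ?L
      unfolding regions_def eq using xin by (auto simp: components_iff)
  qed
qed

lemma finite_regions:
  fixes S :: "'a::real_inner set"
  assumes "convex S" "S \<inter> \<Union>\<B> = S \<inter> \<Union>(arrangement w a J)" "finite J"
  shows "finite (regions S \<B>)"
proof (rule finite_subset)
  show "regions S \<B> \<subseteq> cell S w a J ` (J \<rightarrow>\<^sub>E {-1, 1})"
  proof
    fix R assume "R \<in> regions S \<B>"
    then obtain s where s: "\<forall>i\<in>J. s i \<in> {-1, 1}" "R = cell S w a J s"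
      using regions_iff_cell[OF assms(1,2)] by blast
    \<comment> \<open>Signs outside \<open>J\<close> do not affect the cell; cutting them off leaves
      finitely many candidate functions.\<close>
    have "R = cell S w a J (restrict s J)"
      unfolding s(2) by (rule cell_cong) simp
    moreover have "restrict s J \<in> J \<rightarrow>\<^sub>E {-1, 1}"
      using s by auto
    ultimately show "R \<in> cell S w a J ` (J \<rightarrow>\<^sub>E {-1, 1})"
      by blast
  qed
  show "finite (cell S w a J ` (J \<rightarrow>\<^sub>E {-1, 1}))"
    using assms(3) by (intro finite_imageI finite_PiE) auto
qed

text \<open>A single point of the cell excludes the opposite sign, so the definite description is
  determined; on an empty set both signs would qualify.\<close>

lemma sign_vector_cell:
  assumes "cell S w a J s \<noteq> {}" "i \<in> J" "s i \<in> {-1, 1}"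
  shows "sign_vector w a (cell S w a J s) i = s i"
  unfolding sign_vector_def
proof (rule the_equality)
  show "s i \<in> {-1, 1} \<and> (\<forall>x\<in>cell S w a J s. 0 < s i * (w i \<bullet> x - a i))"
    using assms by (auto simp: cell_def)
next
  obtain x where x: "x \<in> cell S w a J s"
    using assms by blast
  fix t assume t: "t \<in> {-1, 1} \<and> (\<forall>x\<in>cell S w a J s. 0 < t * (w i \<bullet> x - a i))"
  then have "0 < t * (w i \<bullet> x - a i)"
    using x by blast
  moreover have "0 < s i * (w i \<bullet> x - a i)"
    using x assms by (auto simp: cell_def)
  ultimately show "t = s i"
    using t assms(3) by auto
qed

section \<open>Recession cones of cells\<close>

lemma nonneg_if_affine_pos:
  fixes p q :: real
  assumes "\<And>m::nat. p + real m * q > 0"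
  shows "q \<ge> 0"
proof (rule ccontr)
  assume "\<not> q \<ge> 0"
  then obtain m :: nat where "p < real m * (- q)"
    using reals_Archimedean3[of "- q"] by auto
  with assms[of m] show False by simp
qed

text \<open>Along x + m v each constraint is affine in m with slope
  \<open>s i * (w i \<bullet> v)\<close>. Staying positive for every m forces a nonnegative slope;
  conversely, a nonnegative increment preserves strict positivity.\<close>

lemma Rec_cell:
  assumes "cell UNIV w a J s \<noteq> {}"
  shows "Rec (cell UNIV w a J s) = {v. \<forall>i\<in>J. s i * (w i \<bullet> v) \<ge> 0}"
proof (intro equalityI subsetI)
  fix v assume v: "v \<in> {v. \<forall>i\<in>J. s i * (w i \<bullet> v) \<ge> 0}"
  have "s i * (w i \<bullet> (x + v) - a i) > 0" if "x \<in> cell UNIV w a J s" "i \<in> J" for x i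
  proof -
    have "s i * (w i \<bullet> (x + v) - a i) = s i * (w i \<bullet> x - a i) + s i * (w i \<bullet> v)"
      by (simp add: inner_right_distrib algebra_simps)
    with v that show ?thesis by (auto simp: cell_def intro: add_pos_nonneg)
  qed
  then show "v \<in> Rec (cell UNIV w a J s)"
    by (auto simp: Rec_def cell_def)
next
  fix v assume v: "v \<in> Rec (cell UNIV w a J s)"
  obtain x where x: "x \<in> cell UNIV w a J s"
    using assms by blast
  have step: "y + v \<in> cell UNIV w a J s" if "y \<in> cell UNIV w a J s" for y
    using v that by (auto simp: Rec_def)
  have mem: "x + real m *\<^sub>R v \<in> cell UNIV w a J s" for m
  proof (induction m)
    case (Suc m)
    from step[OF this] show ?case by (simp add: algebra_simps)
  qed (simp add: x)
  have "s i * (w i \<bullet> v) \<ge> 0" if i: "i \<in> J" for i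
  proof (rule nonneg_if_affine_pos)
    fix m :: nat
    have "0 < s i * (w i \<bullet> (x + real m *\<^sub>R v) - a i)"
      using mem[of m] i by (auto simp: cell_def)
    then show "s i * (w i \<bullet> x - a i) + real m * (s i * (w i \<bullet> v)) > 0"
      by (simp add: inner_right_distrib algebra_simps)
  qed
  then show "v \<in> {v. \<forall>i\<in>J. s i * (w i \<bullet> v) \<ge> 0}"
    by simp
qed

text \<open>A recession direction in \<open>W\<close> generates a ray inside the cell. Conversely,
  an unbounded cell contains points going to infinity; by compactness of the unit sphere their
  normalizations have a limit point, which is a nonzero recession direction.\<close>

lemma bounded_cell_iff:
  fixes W :: "'a::euclidean_space set"
  assumes W: "subspace W" and ne: "cell W w a J s \<noteq> {}"
  shows "bounded (cell W w a J s) \<longleftrightarrow> (\<forall>v\<in>W. (\<forall>i\<in>J. s i * (w i \<bullet> v) \<ge> 0) \<longrightarrow> v = 0)"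
proof
  assume bdd: "bounded (cell W w a J s)"
  show "\<forall>v\<in>W. (\<forall>i\<in>J. s i * (w i \<bullet> v) \<ge> 0) \<longrightarrow> v = 0"
  proof (intro ballI impI)
    fix v assume v: "v \<in> W" "\<forall>i\<in>J. s i * (w i \<bullet> v) \<ge> 0"
    obtain x where x: "x \<in> cell W w a J s"
      using ne by blast
    obtain K where K: "\<And>y. y \<in> cell W w a J s \<Longrightarrow> norm y \<le> K"
      using bdd by (auto simp: bounded_iff)
    have mem: "x + real m *\<^sub>R v \<in> cell W w a J s" for m
    proof -
      have "s i * (w i \<bullet> (x + real m *\<^sub>R v) - a i) > 0" if "i \<in> J" for i
      proof -
        have "s i * (w i \<bullet> (x + real m *\<^sub>R v) - a i)
            = s i * (w i \<bullet> x - a i) + real m * (s i * (w i \<bullet> v))"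
          by (simp add: inner_right_distrib algebra_simps)
        also have "\<dots> > 0"
        proof (rule add_pos_nonneg)
          show "0 < s i * (w i \<bullet> x - a i)"
            using x that by (simp add: cell_def)
          show "0 \<le> real m * (s i * (w i \<bullet> v))"
            by (intro mult_nonneg_nonneg[of "real m"]) (use v that in auto)
        qed
        finally show ?thesis .
      qed
      moreover have "x + real m *\<^sub>R v \<in> W"
        using W x v by (auto simp: cell_def intro: subspace_add subspace_scale)
      ultimately show ?thesis by (simp add: cell_def)
    qed
    have "real m * norm v \<le> K + norm x" for m
      using K[OF mem[of m]] norm_triangle_ineq4[of "x + real m *\<^sub>R v" x] by simp
    then have "\<not> norm v > 0"
      using reals_Archimedean3[of "norm v"] by (meson not_less)
    then show "v = 0" by simp
  qed
next
  assume triv: "\<forall>v\<in>W. (\<forall>i\<in>J. s i * (w i \<bullet> v) \<ge> 0) \<longrightarrow> v = 0"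
  show "bounded (cell W w a J s)"
  proof (rule ccontr)
    assume "\<not> bounded (cell W w a J s)"
    \<comment> \<open>The bound \<open>Suc m\<close> keeps the norms positive from the first term on
      and matches the null sequence 1/(m+1) used below.\<close>
    then have "\<exists>x\<in>cell W w a J s. norm x > real (Suc m)" for m
      unfolding bounded_iff by (meson not_less)
    then obtain x where x: "\<And>m. x m \<in> cell W w a J s" "\<And>m. norm (x m) > real (Suc m)"
      by metis
    have npos: "norm (x m) > 0" for m
      using x(2)[of m] by linarith
    have "seq_compact (sphere (0::'a) 1)"
      by (intro compact_imp_seq_compact) simp
    moreover have "\<forall>m. x m /\<^sub>R norm (x m) \<in> sphere 0 1"
      using npos by (auto simp: less_imp_neq)
    ultimately obtain v r where v: "v \<in> sphere 0 1" and r: "strict_mono r"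
      and lim: "(\<lambda>m. x (r m) /\<^sub>R norm (x (r m))) \<longlonglongrightarrow> v"
      by (rule seq_compactE) (auto simp: comp_def)
    have inv0: "(\<lambda>m. inverse (norm (x m))) \<longlonglongrightarrow> 0"
    proof (rule tendsto_sandwich[OF _ _ tendsto_const LIMSEQ_inverse_real_of_nat])
      show "\<forall>\<^sub>F m in sequentially. inverse (norm (x m)) \<le> inverse (real (Suc m))"
        using x(2) by (intro always_eventually allI le_imp_inverse_le) (auto intro: less_imp_le)
    qed simp
    then have inv0r: "(\<lambda>m. inverse (norm (x (r m)))) \<longlonglongrightarrow> 0"
      using LIMSEQ_subseq_LIMSEQ[OF inv0 r] by (simp add: comp_def)
    have "v \<in> W"
    proof (rule closed_sequentially[OF closed_subspace[OF W] _ lim])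
      show "x (r m) /\<^sub>R norm (x (r m)) \<in> W" for m
        using x(1)[of "r m"] W by (auto simp: cell_def intro: subspace_scale)
    qed
    \<comment> \<open>Dividing the constraint at \<open>x m\<close> by the norm turns the constant
      \<open>a i\<close> into a term that tends to 0, so the homogeneous inequality survives in the
      limit.\<close>
    moreover have "s i * (w i \<bullet> v) \<ge> 0" if i: "i \<in> J" for i
    proof (rule LIMSEQ_le_const)
      have "(\<lambda>m. s i * (w i \<bullet> (x (r m) /\<^sub>R norm (x (r m))) - a i * inverse (norm (x (r m)))))
          \<longlonglongrightarrow> s i * (w i \<bullet> v - a i * 0)"
        by (intro tendsto_intros lim inv0r)
      then show "(\<lambda>m. s i * (w i \<bullet> (x (r m) /\<^sub>R norm (x (r m))) - a i * inverse (norm (x (r m)))))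
          \<longlonglongrightarrow> s i * (w i \<bullet> v)"
        by simp
      have "0 \<le> s i * (w i \<bullet> (x m /\<^sub>R norm (x m)) - a i * inverse (norm (x m)))" for m
      proof -
        have "0 \<le> (s i * (w i \<bullet> x m - a i)) * inverse (norm (x m))"
          using x(1)[of m] i npos[of m] by (auto simp: cell_def)
        then show ?thesis by (simp add: algebra_simps)
      qed
      then show "\<exists>N. \<forall>n\<ge>N. 0 \<le> s i * (w i \<bullet> (x (r n) /\<^sub>R norm (x (r n)))
          - a i * inverse (norm (x (r n))))"
        by blast
    qed
    ultimately have "v = 0"
      using triv by blast
    with v show False by simp
  qed
qed

text \<open>Needed because \<open>normal_span\<close> ranges over all equations of a hyperplane, not
  just the given one: any two normals of the same hyperplane must be parallel.\<close>

lemma hyperplane_subset_imp_normal_in_span: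
  fixes w u :: "'a::real_inner"
  assumes "u \<noteq> 0" "hyperplane u b \<subseteq> hyperplane w a"
  shows "w \<in> span {u}"
proof -
  \<comment> \<open>\<open>c *\<^sub>R u\<close> is the projection of \<open>w\<close> to the line
    of \<open>u\<close>, \<open>y\<close> is the remainder orthogonal to \<open>u\<close>, and
    \<open>x\<close> is the point of \<open>hyperplane u b\<close> nearest the origin.\<close>
  define c where "c = (w \<bullet> u) / (u \<bullet> u)"
  define y where "y = w - c *\<^sub>R u"
  define x where "x = (b / (u \<bullet> u)) *\<^sub>R u"
  have uy: "u \<bullet> y = 0"
    using assms(1) by (simp add: y_def c_def inner_diff_right inner_commute)
  have x: "x \<in> hyperplane u b" "x + y \<in> hyperplane u b"
    using assms(1) uy by (auto simp: x_def hyperplane_def inner_right_distrib)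
  then have "x \<in> hyperplane w a" "x + y \<in> hyperplane w a"
    using assms(2) by blast+
  then have "w \<bullet> y = 0"
    by (simp add: hyperplane_def inner_right_distrib)
  then have "y \<bullet> y = 0"
    using uy by (simp add: y_def inner_diff_left)
  then have "w = c *\<^sub>R u"
    by (simp add: y_def)
  then show ?thesis
    by (metis span_base span_scale singletonI)
qed

text \<open>Finitely many strict inequalities persist as e tends to 0 from the right. This supplies
  every small coefficient below.\<close>

lemma small_perturbation_pos:
  fixes p q :: "'i \<Rightarrow> real"
  assumes "finite J" "\<And>i. i \<in> J \<Longrightarrow> p i > 0"
  obtains e where "e > 0" "\<And>i. i \<in> J \<Longrightarrow> p i + e * q i > 0"
proof -
  have "\<forall>\<^sub>F e in at_right 0. \<forall>i\<in>J. p i + e * q i > 0"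
  proof (intro eventually_ball_finite assms(1) ballI)
    fix i assume "i \<in> J"
    have "((\<lambda>e. p i + e * q i) \<longlongrightarrow> p i + 0 * q i) (at_right 0)"
      by (intro tendsto_intros)
    then show "\<forall>\<^sub>F e in at_right 0. p i + e * q i > 0"
      using assms(2)[OF \<open>i \<in> J\<close>] by (auto dest: order_tendstoD)
  qed
  then have "\<forall>\<^sub>F e in at_right (0::real). e > 0 \<and> (\<forall>i\<in>J. p i + e * q i > 0)"
    using eventually_at_right_less by (rule eventually_elim2) simp
  then obtain e where "e > 0" "\<forall>i\<in>J. p i + e * q i > 0"
    using eventually_happens' trivial_limit_at_right_real by blast
  then show thesis
    using that by blast
qed

section \<open>Splitting an arrangement along a flat\<close>

locale arrangement_flat =
  fixes w :: "'i \<Rightarrow> 'a::euclidean_space" and a :: "'i \<Rightarrow> real" and I :: "'i set" and V :: "'a set"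
  assumes finite: "finite I"
    and nonzero: "\<And>i. i \<in> I \<Longrightarrow> w i \<noteq> 0"
    and flat: "V \<in> intersection_poset (centralization w I)"
begin

abbreviation "Iu \<equiv> I_u w I V"
abbreviation "Ib \<equiv> I_b w I V"
abbreviation "\<A> \<equiv> arrangement w a I"
abbreviation "\<A>V \<equiv> restriction (centralization w I) V"
abbreviation "\<A>loc \<equiv> localization \<A> V"
abbreviation "N \<equiv> span (w ` Ib)"

section \<open>The flat, its orthogonal complement and the two derived arrangements\<close>

lemma I_split: "I = Iu \<union> Ib"
  by (auto simp: I_u_def I_b_def)

lemma Iu_sub: "Iu \<subseteq> I" and Ib_sub: "Ib \<subseteq> I"
  by (auto simp: I_u_def I_b_def)

text \<open>Every hyperplane in a family cutting out \<open>V\<close> contains \<open>V\<close>, so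
  its index lies in \<open>Ib\<close>. This is where membership in the intersection poset
  enters.\<close>

lemma mem_V_iff: "x \<in> V \<longleftrightarrow> (\<forall>i\<in>Ib. w i \<bullet> x = 0)"
proof
  show "x \<in> V \<Longrightarrow> \<forall>i\<in>Ib. w i \<bullet> x = 0"
    by (auto simp: I_b_def hyperplane_def)
next
  assume x: "\<forall>i\<in>Ib. w i \<bullet> x = 0"
  obtain \<C> where C: "\<C> \<subseteq> centralization w I" "V = \<Inter>\<C>"
    using flat by (auto simp: intersection_poset_def)
  have "x \<in> H" if "H \<in> \<C>" for H
  proof -
    have "H \<in> centralization w I"
      using C(1) that by blast
    then obtain i where i: "i \<in> I" "H = hyperplane (w i) 0"
      unfolding centralization_def by blast
    then have "i \<in> Ib"
      using C(2) that by (auto simp: I_b_def)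
    then show ?thesis
      using x i by (simp add: hyperplane_def)
  qed
  then show "x \<in> V"
    using C by blast
qed

lemma subspace_V: "subspace V"
  by (auto simp: subspace_def mem_V_iff inner_right_distrib)

lemma Iu_witness:
  assumes "i \<in> Iu"
  obtains v where "v \<in> V" "w i \<bullet> v \<noteq> 0"
  using assms by (auto simp: I_u_def hyperplane_def)

text \<open>Central hyperplanes all meet \<open>V\<close> in the origin, so no trace is empty, and
  removing the trace \<open>V\<close> removes exactly the indices in \<open>Ib\<close>.\<close>

lemma restriction_eq: "\<A>V = (\<lambda>i. hyperplane (w i) 0 \<inter> V) ` Iu"
proof -
  have "0 \<in> hyperplane (w i) 0 \<inter> V" for i
    using subspace_0[OF subspace_V] by (simp add: hyperplane_def)
  then have "hyperplane (w i) 0 \<inter> V \<noteq> {}" for i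
    by blast
  moreover have "hyperplane (w i) 0 \<inter> V = V \<longleftrightarrow> V \<subseteq> hyperplane (w i) 0" for i
    by blast
  ultimately show ?thesis
    unfolding restriction_def centralization_def I_u_def by auto
qed

text \<open>A functional that is nonzero on \<open>V\<close> takes every real value there, so
  \<open>V\<close> meets the affine hyperplane without lying in it. If it vanishes on
  \<open>V\<close>, the two alternatives correspond to \<open>a i\<close> being zero or not.\<close>

lemma localization_iff:
  assumes "i \<in> I"
  shows "V \<subseteq> hyperplane (w i) (a i) \<or> V \<inter> hyperplane (w i) (a i) = {} \<longleftrightarrow> i \<in> Ib"
proof
  assume L: "V \<subseteq> hyperplane (w i) (a i) \<or> V \<inter> hyperplane (w i) (a i) = {}"
  show "i \<in> Ib"
  proof (rule ccontr)
    assume "i \<notin> Ib"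
    then have "i \<in> Iu"
      using assms I_split by blast
    then obtain v where v: "v \<in> V" "w i \<bullet> v \<noteq> 0"
      by (rule Iu_witness)
    \<comment> \<open>The two multiples of \<open>v\<close> have \<open>w i\<close>-values
      \<open>a i\<close> and \<open>a i + 1\<close>.\<close>
    have "(a i / (w i \<bullet> v)) *\<^sub>R v \<in> V \<inter> hyperplane (w i) (a i)"
      using v subspace_V by (auto simp: hyperplane_def intro: subspace_scale)
    moreover have "((a i + 1) / (w i \<bullet> v)) *\<^sub>R v \<in> V - hyperplane (w i) (a i)"
      using v subspace_V by (auto simp: hyperplane_def intro: subspace_scale)
    ultimately show False
      using L by blast
  qed
next
  assume "i \<in> Ib"
  then have "w i \<bullet> x = 0" if "x \<in> V" for x
    using that mem_V_iff by blast
  then show "V \<subseteq> hyperplane (w i) (a i) \<or> V \<inter> hyperplane (w i) (a i) = {}"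
    by (cases "a i = 0") (auto simp: hyperplane_def)
qed

lemma localization_eq: "\<A>loc = arrangement w a Ib"
  using localization_iff Ib_sub unfolding localization_def arrangement_def by blast

lemma normal_span_localization: "normal_span \<A>loc = N"
  unfolding normal_span_def localization_eq
proof (rule span_eq[THEN iffD2], intro conjI subsetI)
  fix u assume "u \<in> {u. u \<noteq> 0 \<and> (\<exists>b. hyperplane u b \<in> arrangement w a Ib)}"
  then obtain b i where "i \<in> Ib" "hyperplane u b = hyperplane (w i) (a i)"
    by (auto simp: arrangement_def)
  then have "u \<in> span {w i}"
    using nonzero Ib_sub by (intro hyperplane_subset_imp_normal_in_span[of "w i" "a i" u b]) auto
  then show "u \<in> N"
    using span_mono[of "{w i}" "w ` Ib"] \<open>i \<in> Ib\<close> by auto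
next
  fix u assume "u \<in> w ` Ib"
  then show "u \<in> span {u. u \<noteq> 0 \<and> (\<exists>b. hyperplane u b \<in> arrangement w a Ib)}"
    using nonzero Ib_sub by (intro span_base) (auto simp: arrangement_def)
qed

text \<open>\<open>N\<close> is the orthogonal complement of \<open>V\<close>: the part of
  \<open>x\<close> orthogonal to all normals with index in \<open>Ib\<close> lies in
  \<open>V\<close> by \<open>mem_V_iff\<close>.\<close>

lemma V_plus_N:
  obtains p q where "p \<in> V" "q \<in> N" "x = p + q"
proof -
  obtain q p where qp: "q \<in> N" "\<And>y. y \<in> N \<Longrightarrow> orthogonal p y" "x = q + p"
    using orthogonal_subspace_decomp_exists[of "w ` Ib" x] by blast
  have "p \<in> V"
    unfolding mem_V_iff
  proof
    fix i assume "i \<in> Ib"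
    then have "orthogonal p (w i)"
      by (intro qp(2) span_base imageI)
    then show "w i \<bullet> p = 0"
      by (simp add: orthogonal_def inner_commute)
  qed
  with qp show thesis
    by (intro that[of p q]) (auto simp: add.commute)
qed

lemma V_inter_N:
  assumes "x \<in> V" "x \<in> N"
  shows "x = 0"
proof -
  have "orthogonal x x"
    by (rule orthogonal_to_span[OF assms(2)])
      (use assms(1) in \<open>auto simp: mem_V_iff orthogonal_def inner_commute\<close>)
  then show ?thesis by (simp add: orthogonal_def)
qed

section \<open>Regions of the three arrangements as sign cells\<close>

lemma regions_iff:
  "R \<in> regions UNIV \<A> \<longleftrightarrow>
    (\<exists>s. (\<forall>i\<in>I. s i \<in> {-1, 1}) \<and> R = cell UNIV w a I s \<and> R \<noteq> {})"
  by (rule regions_iff_cell) auto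

lemma restriction_Union: "V \<inter> \<Union>\<A>V = V \<inter> \<Union>(arrangement w (\<lambda>_. 0) Iu)"
  by (auto simp: restriction_eq arrangement_def)

lemma regions_restriction_iff:
  "R \<in> regions V \<A>V \<longleftrightarrow>
    (\<exists>s. (\<forall>i\<in>Iu. s i \<in> {-1, 1}) \<and> R = cell V w (\<lambda>_. 0) Iu s \<and> R \<noteq> {})"
  by (rule regions_iff_cell[OF subspace_imp_convex[OF subspace_V] restriction_Union])

lemma rel_bounded_iff:
  "R \<in> rel_bounded_regions \<A>loc \<longleftrightarrow>
    (\<exists>s. (\<forall>i\<in>Ib. s i \<in> {-1, 1}) \<and> R = cell UNIV w a Ib s \<and> R \<noteq> {} \<and> bounded (cell N w a Ib s))"
proof -
  have "R \<in> regions UNIV \<A>loc \<longleftrightarrow>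
      (\<exists>s. (\<forall>i\<in>Ib. s i \<in> {-1, 1}) \<and> R = cell UNIV w a Ib s \<and> R \<noteq> {})"
    unfolding localization_eq by (rule regions_iff_cell) auto
  moreover have "cell UNIV w a Ib s \<inter> N = cell N w a Ib s" for s
    by (auto simp: cell_def)
  ultimately show ?thesis
    unfolding rel_bounded_regions_def normal_span_localization by auto
qed

lemma finite_regions_restriction: "finite (regions V \<A>V)"
  using finite_regions[OF subspace_imp_convex[OF subspace_V] restriction_Union]
    finite_subset[OF Iu_sub finite] by blast

lemma finite_rel_bounded_regions: "finite (rel_bounded_regions \<A>loc)"
proof -
  have "finite (regions UNIV \<A>loc)"
    unfolding localization_eq
    by (rule finite_regions[where w = w and a = a and J = Ib])
      (use finite_subset[OF Ib_sub finite] in auto)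
  then show ?thesis
    by (auto simp: rel_bounded_regions_def)
qed

text \<open>The functionals with index in \<open>Ib\<close> vanish on \<open>V\<close>, so
  projecting a point to \<open>N\<close> keeps its signs. This provides the nonemptiness that
  \<open>bounded_cell_iff\<close> asks for.\<close>

lemma cell_N_nonempty:
  assumes "cell UNIV w a Ib s \<noteq> {}"
  shows "cell N w a Ib s \<noteq> {}"
proof -
  obtain x where x: "x \<in> cell UNIV w a Ib s"
    using assms by blast
  obtain p q where pq: "p \<in> V" "q \<in> N" "x = p + q"
    by (rule V_plus_N)
  then have "w i \<bullet> q = w i \<bullet> x" if "i \<in> Ib" for i
    using that by (simp add: mem_V_iff inner_right_distrib)
  then have "q \<in> cell N w a Ib s"
    using x pq by (auto simp: cell_def)
  then show ?thesis by blast
qed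

section \<open>Recession span \<open>V\<close> versus the pair of cells\<close>

lemma cells_if_rec_span:
  assumes ne: "cell UNIV w a I s \<noteq> {}" and span: "rec_span (cell UNIV w a I s) = V"
  shows "cell V w (\<lambda>_. 0) Iu s \<noteq> {}" "cell UNIV w a Ib s \<noteq> {}" "bounded (cell N w a Ib s)"
proof -
  let ?P = "{v. \<forall>i\<in>I. s i * (w i \<bullet> v) \<ge> 0}"
  have spanP: "span ?P = V"
    using span by (simp add: rec_span_def Rec_cell[OF ne])
  then have P_sub_V: "?P \<subseteq> V"
    using span_superset[of ?P] by simp
  \<comment> \<open>If \<open>w i\<close> vanished on all recession directions, it would vanish on
    their span \<open>V\<close>, contrary to the choice of \<open>i\<close> in
    \<open>Iu\<close>.\<close>
  have "\<forall>i\<in>Iu. \<exists>v. v \<in> ?P \<and> w i \<bullet> v \<noteq> 0"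
  proof (intro ballI, rule ccontr)
    fix i assume i: "i \<in> Iu"
    assume "\<nexists>v. v \<in> ?P \<and> w i \<bullet> v \<noteq> 0"
    then have "?P \<subseteq> {x. w i \<bullet> x = 0}" by blast
    then have "V \<subseteq> {x. w i \<bullet> x = 0}"
      using spanP span_minimal[OF _ subspace_hyperplane] by blast
    with i show False
      by (simp add: I_u_def hyperplane_def)
  qed
  from bchoice[OF this] obtain f
    where f: "\<And>i. i \<in> Iu \<Longrightarrow> f i \<in> ?P" "\<And>i. i \<in> Iu \<Longrightarrow> w i \<bullet> f i \<noteq> 0"
    by blast
  have finIu: "finite Iu"
    using finite_subset[OF Iu_sub finite] .
  have s_ne: "s i \<noteq> 0" if "i \<in> I" for i
    using ne that by (auto simp: cell_def)
  \<comment> \<open>For each \<open>i\<close> in \<open>Iu\<close> every summand contributes a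
    nonnegative amount, and \<open>f i\<close> itself a positive one.\<close>
  define v where "v = (\<Sum>j\<in>Iu. f j)"
  have sum: "s i * (w i \<bullet> v) = (\<Sum>j\<in>Iu. s i * (w i \<bullet> f j))" for i
    by (simp add: v_def inner_sum_right sum_distrib_left)
  have v_pos: "s i * (w i \<bullet> v) > 0" if "i \<in> Iu" for i
    unfolding sum
  proof (rule sum_pos2[OF finIu that])
    have "s i * (w i \<bullet> f i) \<noteq> 0" "s i * (w i \<bullet> f i) \<ge> 0"
      using f[OF that] s_ne that Iu_sub by auto
    then show "0 < s i * (w i \<bullet> f i)" by linarith
  qed (use f that Iu_sub in auto)
  have "v \<in> V"
    unfolding v_def using f(1) P_sub_V by (intro subspace_sum[OF subspace_V]) (rule subsetD)
  then show "cell V w (\<lambda>_. 0) Iu s \<noteq> {}"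
    using v_pos by (auto simp: cell_def)
  show neb: "cell UNIV w a Ib s \<noteq> {}"
    using ne Ib_sub by (auto simp: cell_def)
  have "q = 0" if q: "q \<in> N" "\<forall>i\<in>Ib. s i * (w i \<bullet> q) \<ge> 0" for q
  proof -
    obtain e where e: "e > 0" "\<And>i. i \<in> Iu \<Longrightarrow> s i * (w i \<bullet> v) + e * (s i * (w i \<bullet> q)) > 0"
      using small_perturbation_pos[OF finIu, of "\<lambda>i. s i * (w i \<bullet> v)" "\<lambda>i. s i * (w i \<bullet> q)"]
        v_pos by blast
    have expand: "s i * (w i \<bullet> (v + e *\<^sub>R q)) = s i * (w i \<bullet> v) + e * (s i * (w i \<bullet> q))" for i
      by (simp add: inner_right_distrib algebra_simps)
    \<comment> \<open>On \<open>Iu\<close> this is the choice of \<open>e\<close>; on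
      \<open>Ib\<close> the term from \<open>v\<close> is zero and only the assumption on
      \<open>q\<close> remains.\<close>
    have "s i * (w i \<bullet> (v + e *\<^sub>R q)) \<ge> 0" if "i \<in> I" for i
    proof (cases "i \<in> Iu")
      case True
      then show ?thesis unfolding expand using e(2) by (simp add: less_imp_le)
    next
      case False
      then have "i \<in> Ib" using that I_split by blast
      then show ?thesis
        unfolding expand using e(1) q(2) \<open>v \<in> V\<close> by (simp add: mem_V_iff)
    qed
    then have "v + e *\<^sub>R q \<in> V"
      by (intro subsetD[OF P_sub_V]) simp
    then have "(v + e *\<^sub>R q) - v \<in> V"
      using \<open>v \<in> V\<close> by (rule subspace_diff[OF subspace_V])
    then have "inverse e *\<^sub>R (e *\<^sub>R q) \<in> V"
      by (intro subspace_scale[OF subspace_V, of "e *\<^sub>R q"]) simp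
    then have "q \<in> V"
      using e(1) by simp
    then show "q = 0"
      using q(1) by (rule V_inter_N)
  qed
  then show "bounded (cell N w a Ib s)"
    using bounded_cell_iff[OF subspace_span cell_N_nonempty[OF neb]] by blast
qed

text \<open>The converse, and the source of surjectivity. Moving along \<open>v\<close> leaves the
  \<open>Ib\<close>-values of \<open>x\<close> unchanged, while far out the \<open>Iu\<close>-signs
  become those of \<open>v\<close>.\<close>

lemma rec_span_if_cells:
  assumes "cell V w (\<lambda>_. 0) Iu s \<noteq> {}" and neb: "cell UNIV w a Ib s \<noteq> {}"
    and bdd: "bounded (cell N w a Ib s)"
  shows "cell UNIV w a I s \<noteq> {}" "rec_span (cell UNIV w a I s) = V"
proof -
  obtain v where v: "v \<in> V" "\<And>i. i \<in> Iu \<Longrightarrow> s i * (w i \<bullet> v) > 0"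
    using assms(1) by (auto simp: cell_def)
  obtain x where x: "\<And>i. i \<in> Ib \<Longrightarrow> s i * (w i \<bullet> x - a i) > 0"
    using neb by (auto simp: cell_def)
  have vb: "w i \<bullet> v = 0" if "i \<in> Ib" for i
    using v(1) that by (simp add: mem_V_iff)
  have finIu: "finite Iu"
    using finite_subset[OF Iu_sub finite] .
  \<comment> \<open>The point \<open>x + t v\<close> with \<open>t\<close> large, rescaled by \<open>e = 1 / t\<close>.\<close>
  obtain e where e: "e > 0"
    "\<And>i. i \<in> Iu \<Longrightarrow> s i * (w i \<bullet> v) + e * (s i * (w i \<bullet> x - a i)) > 0"
    using small_perturbation_pos[OF finIu, of "\<lambda>i. s i * (w i \<bullet> v)"
        "\<lambda>i. s i * (w i \<bullet> x - a i)"] v(2) by blast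
  have "s i * (w i \<bullet> (x + inverse e *\<^sub>R v) - a i) > 0" if "i \<in> I" for i
  proof (cases "i \<in> Ib")
    case True
    then show ?thesis using x vb by (simp add: inner_right_distrib)
  next
    case False
    then have "i \<in> Iu" using that I_split by blast
    then have "0 < inverse e * (s i * (w i \<bullet> v) + e * (s i * (w i \<bullet> x - a i)))"
      using e by simp
    also have "\<dots> = s i * (w i \<bullet> (x + inverse e *\<^sub>R v) - a i)"
      using e(1) by (simp add: inner_right_distrib field_simps)
    finally show ?thesis .
  qed
  then have "x + inverse e *\<^sub>R v \<in> cell UNIV w a I s"
    by (simp add: cell_def)
  then show ne: "cell UNIV w a I s \<noteq> {}" by blast
  let ?P = "{v. \<forall>i\<in>I. s i * (w i \<bullet> v) \<ge> 0}"
  \<comment> \<open>The \<open>N\<close>-component of a recession direction has the same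
    \<open>Ib\<close>-values, so it is a recession direction of the bounded cell in \<open>N\<close>
    and must vanish.\<close>
  have "?P \<subseteq> V"
  proof
    fix u assume u: "u \<in> ?P"
    obtain p q where pq: "p \<in> V" "q \<in> N" "u = p + q"
      by (rule V_plus_N)
    have "s i * (w i \<bullet> q) \<ge> 0" if "i \<in> Ib" for i
    proof -
      have "w i \<bullet> q = w i \<bullet> u"
        using pq that by (simp add: mem_V_iff inner_right_distrib)
      then show ?thesis using u that Ib_sub by auto
    qed
    then have "q = 0"
      using bdd bounded_cell_iff[OF subspace_span cell_N_nonempty[OF neb]] pq(2) by blast
    then show "u \<in> V" using pq by simp
  qed
  moreover have "V \<subseteq> span ?P"
  proof
    fix y assume y: "y \<in> V"
    \<comment> \<open>Both \<open>v\<close> and \<open>v + d *\<^sub>R y\<close> are recession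
      directions, so their difference puts \<open>y\<close> in the span.\<close>
    obtain d where d: "d > 0" "\<And>i. i \<in> Iu \<Longrightarrow> s i * (w i \<bullet> v) + d * (s i * (w i \<bullet> y)) > 0"
      using small_perturbation_pos[OF finIu, of "\<lambda>i. s i * (w i \<bullet> v)" "\<lambda>i. s i * (w i \<bullet> y)"]
        v(2) by blast
    have "s i * (w i \<bullet> v) \<ge> 0 \<and> s i * (w i \<bullet> (v + d *\<^sub>R y)) \<ge> 0" if "i \<in> I" for i
    proof (cases "i \<in> Iu")
      case True
      have "s i * (w i \<bullet> (v + d *\<^sub>R y)) = s i * (w i \<bullet> v) + d * (s i * (w i \<bullet> y))"
        by (simp add: inner_right_distrib algebra_simps)
      then show ?thesis using d(2)[OF True] v(2)[OF True] by simp
    next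
      case False
      then have "i \<in> Ib" using that I_split by blast
      then show ?thesis using vb y by (simp add: mem_V_iff inner_right_distrib)
    qed
    then have "(v + d *\<^sub>R y) - v \<in> span ?P"
      by (intro span_diff span_base) auto
    then have "inverse d *\<^sub>R (d *\<^sub>R y) \<in> span ?P"
      by (intro span_scale[of "d *\<^sub>R y"]) simp
    then show "y \<in> span ?P"
      using d(1) by simp
  qed
  ultimately show "rec_span (cell UNIV w a I s) = V"
    unfolding rec_span_def Rec_cell[OF ne] using span_minimal[OF _ subspace_V] by blast
qed

section \<open>The map \<open>Phi\<close>, its bijectivity and its inverse\<close>

lemma Phi_cell:
  assumes "cell UNIV w a I s \<noteq> {}" "\<forall>i\<in>I. s i \<in> {-1, 1}"
  shows "Phi w a I V (cell UNIV w a I s) = (cell V w (\<lambda>_. 0) Iu s, cell UNIV w a Ib s)"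
proof -
  have "sign_vector w a (cell UNIV w a I s) i = s i" if "i \<in> I" for i
    using sign_vector_cell[OF assms(1) that] assms(2) that by blast
  then have "sign_vector w a (cell UNIV w a I s) i = s i" if "i \<in> Iu \<union> Ib" for i
    using that I_split by blast
  then show ?thesis
    unfolding Phi_def R_u_def R_b_def cell_def[of V] cell_def[of UNIV w a Ib] by simp
qed

text \<open>The description of the inverse. Signs of \<open>Ru\<close> refer to the homogeneous
  equations, since \<open>Ru\<close> belongs to the centralized arrangement; those of
  \<open>Rb\<close> refer to the original affine ones.\<close>

definition signs_match :: "'a set \<Rightarrow> 'a set \<Rightarrow> 'a set \<Rightarrow> bool" where
  "signs_match R Ru Rb \<longleftrightarrow>
    (\<forall>i\<in>Iu. sign_vector w a R i = sign_vector w (\<lambda>_. 0) Ru i) \<and>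
    (\<forall>i\<in>Ib. sign_vector w a R i = sign_vector w a Rb i)"

lemma signs_match_cells:
  assumes "\<forall>i\<in>I. s i \<in> {-1, 1}"
    and "cell UNIV w a I s \<noteq> {}" "cell V w (\<lambda>_. 0) Iu s \<noteq> {}" "cell UNIV w a Ib s \<noteq> {}"
  shows "signs_match (cell UNIV w a I s) (cell V w (\<lambda>_. 0) Iu s) (cell UNIV w a Ib s)"
proof -
  have "sign_vector w a (cell UNIV w a I s) i = s i" if "i \<in> I" for i
    using sign_vector_cell[OF assms(2) that] assms(1) that by blast
  moreover have "sign_vector w (\<lambda>_. 0) (cell V w (\<lambda>_. 0) Iu s) i = s i" if "i \<in> Iu" for i
    using sign_vector_cell[OF assms(3) that] assms(1) that Iu_sub by blast
  moreover have "sign_vector w a (cell UNIV w a Ib s) i = s i" if "i \<in> Ib" for i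
    using sign_vector_cell[OF assms(4) that] assms(1) that Ib_sub by blast
  ultimately show ?thesis
    using Iu_sub Ib_sub by (auto simp: signs_match_def)
qed

lemma Phi_region:
  assumes "R \<in> regions_with_span \<A> V" "Phi w a I V R = (Ru, Rb)"
  shows "Ru \<in> regions V \<A>V" "Rb \<in> rel_bounded_regions \<A>loc" "signs_match R Ru Rb"
proof -
  obtain s where s: "\<forall>i\<in>I. s i \<in> {-1, 1}" "R = cell UNIV w a I s" "R \<noteq> {}"
    using assms(1) by (auto simp: regions_with_span_def regions_iff)
  have span: "rec_span R = V"
    using assms(1) by (simp add: regions_with_span_def)
  have ne: "cell UNIV w a I s \<noteq> {}"
    using s by simp
  have Ru: "Ru = cell V w (\<lambda>_. 0) Iu s" and Rb: "Rb = cell UNIV w a Ib s"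
    using Phi_cell[OF ne s(1)] assms(2) s(2) by auto
  note cells = cells_if_rec_span[OF ne span[unfolded s(2)]]
  show "Ru \<in> regions V \<A>V"
    unfolding regions_restriction_iff using cells s(1) Iu_sub Ru by blast
  show "Rb \<in> rel_bounded_regions \<A>loc"
    unfolding rel_bounded_iff using cells s(1) Ib_sub Rb by blast
  show "signs_match R Ru Rb"
    unfolding s(2) Ru Rb by (rule signs_match_cells[OF s(1) ne cells(1,2)])
qed

lemma region_eqI:
  assumes "R \<in> regions UNIV \<A>" "R' \<in> regions UNIV \<A>"
    and eq: "\<And>i. i \<in> I \<Longrightarrow> sign_vector w a R i = sign_vector w a R' i"
  shows "R = R'"
proof -
  obtain s where s: "\<forall>i\<in>I. s i \<in> {-1, 1}" "R = cell UNIV w a I s" "R \<noteq> {}"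
    using assms(1) by (auto simp: regions_iff)
  obtain t where t: "\<forall>i\<in>I. t i \<in> {-1, 1}" "R' = cell UNIV w a I t" "R' \<noteq> {}"
    using assms(2) by (auto simp: regions_iff)
  have "s i = t i" if "i \<in> I" for i
    using sign_vector_cell[of UNIV w a I s i] sign_vector_cell[of UNIV w a I t i] eq[OF that] s t that
    by metis
  then show ?thesis
    unfolding s(2) t(2) by (rule cell_cong)
qed

text \<open>Used twice: for injectivity of \<open>Phi\<close>, and to identify the preimage of a
  pair by its signs alone.\<close>

lemma signs_match_unique:
  assumes "R \<in> regions UNIV \<A>" "R' \<in> regions UNIV \<A>" "signs_match R Ru Rb" "signs_match R' Ru Rb"
  shows "R = R'"
proof (rule region_eqI[OF assms(1,2)])
  fix i assume "i \<in> I"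
  then consider "i \<in> Iu" | "i \<in> Ib" using I_split by blast
  then show "sign_vector w a R i = sign_vector w a R' i"
    using assms(3,4) by cases (auto simp: signs_match_def)
qed

lemma Phi_surj:
  assumes "Ru \<in> regions V \<A>V" "Rb \<in> rel_bounded_regions \<A>loc"
  shows "\<exists>R\<in>regions_with_span \<A> V. Phi w a I V R = (Ru, Rb)"
proof -
  obtain s where s: "\<forall>i\<in>Iu. s i \<in> {-1, 1}" "Ru = cell V w (\<lambda>_. 0) Iu s" "Ru \<noteq> {}"
    using assms(1) by (auto simp: regions_restriction_iff)
  obtain t where t: "\<forall>i\<in>Ib. t i \<in> {-1, 1}" "Rb = cell UNIV w a Ib t" "Rb \<noteq> {}"
    "bounded (cell N w a Ib t)"
    using assms(2) by (auto simp: rel_bounded_iff)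
  \<comment> \<open>Since \<open>Iu\<close> and \<open>Ib\<close> partition \<open>I\<close>, the
    two sign vectors glue without conflict.\<close>
  define r where "r i = (if i \<in> Iu then s i else t i)" for i
  have rb: "r i = t i" if "i \<in> Ib" for i
    using that by (auto simp: r_def I_u_def I_b_def)
  have r: "\<forall>i\<in>I. r i \<in> {-1, 1}"
    using s(1) t(1) I_split by (auto simp: r_def)
  have Ru: "Ru = cell V w (\<lambda>_. 0) Iu r"
    unfolding s(2) by (rule cell_cong) (simp add: r_def)
  \<comment> \<open>Applied with \<open>UNIV\<close> for the region and with \<open>N\<close> for
    its boundedness.\<close>
  have Rb: "cell S w a Ib t = cell S w a Ib r" for S
    by (rule cell_cong) (simp add: rb)
  have ne: "cell UNIV w a I r \<noteq> {}" and span: "rec_span (cell UNIV w a I r) = V"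
    using rec_span_if_cells[of r] Ru s(3) t(2-4) Rb by auto
  have "cell UNIV w a I r \<in> regions UNIV \<A>"
    unfolding regions_iff using r ne by blast
  then show ?thesis
    using span Phi_cell[OF ne r] Ru t(2) Rb
    by (intro bexI[of _ "cell UNIV w a I r"]) (auto simp: regions_with_span_def)
qed

lemma bij_betw_Phi:
  "bij_betw (Phi w a I V) (regions_with_span \<A> V)
    (regions V \<A>V \<times> rel_bounded_regions \<A>loc)"
  unfolding bij_betw_def
proof
  show "inj_on (Phi w a I V) (regions_with_span \<A> V)"
  proof (rule inj_onI)
    fix R R' assume R: "R \<in> regions_with_span \<A> V" "R' \<in> regions_with_span \<A> V"
      and eq: "Phi w a I V R = Phi w a I V R'"
    obtain Ru Rb where P: "Phi w a I V R = (Ru, Rb)" by fastforce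
    show "R = R'"
    proof (rule signs_match_unique)
      show "signs_match R Ru Rb" "signs_match R' Ru Rb"
        using Phi_region(3) R P eq by auto
    qed (use R in \<open>auto simp: regions_with_span_def\<close>)
  qed
  show "Phi w a I V ` regions_with_span \<A> V = regions V \<A>V \<times> rel_bounded_regions \<A>loc"
  proof (intro equalityI subsetI)
    fix P assume "P \<in> Phi w a I V ` regions_with_span \<A> V"
    then show "P \<in> regions V \<A>V \<times> rel_bounded_regions \<A>loc"
      using Phi_region(1,2)[of _ "fst P" "snd P"] by (auto simp: mem_Times_iff)
  next
    fix P assume "P \<in> regions V \<A>V \<times> rel_bounded_regions \<A>loc"
    then show "P \<in> Phi w a I V ` regions_with_span \<A> V"
      using Phi_surj[of "fst P" "snd P"] by (auto simp: mem_Times_iff image_iff)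
  qed
qed

text \<open>The preimage of the pair is a region with matching signs, and only one region has them.
  Hence any region with these signs automatically has recession span \<open>V\<close>.\<close>

lemma inv_Phi_iff:
  assumes "Ru \<in> regions V \<A>V" "Rb \<in> rel_bounded_regions \<A>loc"
  shows "R = inv_into (regions_with_span \<A> V) (Phi w a I V) (Ru, Rb) \<longleftrightarrow>
    R \<in> regions UNIV \<A> \<and> signs_match R Ru Rb"
proof -
  define Q where "Q = inv_into (regions_with_span \<A> V) (Phi w a I V) (Ru, Rb)"
  have "(Ru, Rb) \<in> Phi w a I V ` regions_with_span \<A> V"
    using bij_betw_Phi assms by (auto simp: bij_betw_def)
  then have Q: "Q \<in> regions_with_span \<A> V" "Phi w a I V Q = (Ru, Rb)"
    unfolding Q_def by (auto intro: inv_into_into f_inv_into_f)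
  then have "Q \<in> regions UNIV \<A>" "signs_match Q Ru Rb"
    using Phi_region(3) by (auto simp: regions_with_span_def)
  then show ?thesis
    unfolding Q_def[symmetric] using signs_match_unique by blast
qed

end

section \<open>The bijection and the count in real coordinate space\<close>

theorem theorem4p1:
  fixes k :: nat and w :: "nat \<Rightarrow> real ^ 'n" and a :: "nat \<Rightarrow> real"
    and I :: "nat set" and \<A> \<A>\<^sub>0 :: "(real ^ 'n) set set" and V :: "(real ^ 'n) set"
  defines "I \<equiv> {1..k}"
    and "\<A> \<equiv> arrangement w a I"
    and "\<A>\<^sub>0 \<equiv> centralization w I"
  assumes nonzero: "\<And>i. i \<in> I \<Longrightarrow> w i \<noteq> 0"
    and V: "V \<in> intersection_poset \<A>\<^sub>0"
  shows "restriction \<A>\<^sub>0 V = (\<lambda>i. hyperplane (w i) 0 \<inter> V) ` I_u w I V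
    \<and> localization \<A> V = (\<lambda>i. hyperplane (w i) (a i)) ` I_b w I V
    \<and> bij_betw (Phi w a I V) (regions_with_span \<A> V)
        (regions V (restriction \<A>\<^sub>0 V) \<times> rel_bounded_regions (localization \<A> V))
    \<and> (\<forall>Ru \<in> regions V (restriction \<A>\<^sub>0 V). \<forall>Rb \<in> rel_bounded_regions (localization \<A> V). \<forall>R.
         R = inv_into (regions_with_span \<A> V) (Phi w a I V) (Ru, Rb) \<longleftrightarrow>
           R \<in> regions UNIV \<A>
           \<and> (\<forall>i \<in> I_u w I V. sign_vector w a R i = sign_vector w (\<lambda>_. 0) Ru i)
           \<and> (\<forall>i \<in> I_b w I V. sign_vector w a R i = sign_vector w a Rb i))
    \<and> finite (regions V (restriction \<A>\<^sub>0 V))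
    \<and> finite (rel_bounded_regions (localization \<A> V))
    \<and> card (regions_with_span \<A> V)
        = num_regions V (restriction \<A>\<^sub>0 V) * num_rel_bounded_regions (localization \<A> V)"
proof -
  interpret arrangement_flat w a I V
    using nonzero V by unfold_locales (auto simp: I_def \<A>\<^sub>0_def)
  show ?thesis
    unfolding \<A>_def \<A>\<^sub>0_def num_regions_def num_rel_bounded_regions_def
      card_cartesian_product[symmetric]
    using restriction_eq localization_eq[unfolded arrangement_def[of w a Ib]] bij_betw_Phi
      inv_Phi_iff[unfolded signs_match_def]
      finite_regions_restriction finite_rel_bounded_regions bij_betw_same_card[OF bij_betw_Phi]
    by (intro conjI ballI allI) simp_all
qed

end
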